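(* There exists a non-closed linear subspace $X \subset L^1[0,1]$ such that $X$, equipped with the norm of $L^1[0,1]$, has the Daugavet property and is smooth, i.e., the norm of $X$ is Gâteaux differentiable at every $f \in X \setminus \{0\}$.
   Context: $L^1[0,1]$ is the real Banach space of (classes of) Lebesgue integrable functions on $[0,1]$ with its usual norm. A (not necessarily complete) normed space $X$ has the Daugavet property if $\|\mathrm{Id} + T\| = 1 + \|T\|$ for every (bounded linear) rank-one operator $T \colon X \to X$. For a normed space $X$ with unit sphere $S_X$ and $x \in X \setminus \{0\}$, the norm of $X$ is Gâteaux differentiable at $x$ if $\lim_{t \to 0} \frac{\|x + t h\| + \|x - t h\| - 2\|x\|}{t} = 0$ for every $h \in S_X$. *)

theory Defs
  imports "HOL-Analysis.Analysis"
begin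

text \<open>
  The partial equivalence relation whose classes are the elements of the real space
  \<open>L\<^sup>1[0,1]\<close>. Representatives are functions on all of \<open>real\<close>, but
  only their values in \<open>{0..1}\<close> (up to null sets) matter.
\<close>

definition L1_rel :: "(real \<Rightarrow> real) \<Rightarrow> (real \<Rightarrow> real) \<Rightarrow> bool" where
  "L1_rel f g \<longleftrightarrow>
     integrable (lebesgue_on {0..1}) f \<and> integrable (lebesgue_on {0..1}) g \<and>
     (AE x in lebesgue_on {0..1}. f x = g x)"

lemma L1_rel_refl_iff: "L1_rel f f \<longleftrightarrow> integrable (lebesgue_on {0..1}) f"
  by (simp add: L1_rel_def)

lemma part_equivp_L1_rel: "part_equivp L1_rel"
proof (rule part_equivpI)
  show "\<exists>f. L1_rel f f"
    by (rule exI[of _ "\<lambda>_. 0"]) (simp add: L1_rel_def)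
  show "symp L1_rel"
    by (rule sympI) (auto simp: L1_rel_def elim: AE_mp)
  show "transp L1_rel"
  proof (rule transpI)
    fix f g h assume "L1_rel f g" "L1_rel g h"
    then show "L1_rel f h"
      unfolding L1_rel_def by (auto elim: eventually_elim2)
  qed
qed

quotient_type L1 = "real \<Rightarrow> real" / partial: L1_rel
  by (rule part_equivp_L1_rel)

instantiation L1 :: real_normed_vector
begin

lift_definition zero_L1 :: L1 is "\<lambda>_. 0"
  by (simp add: L1_rel_def)

lift_definition plus_L1 :: "L1 \<Rightarrow> L1 \<Rightarrow> L1" is "\<lambda>f g x. f x + g x"
  unfolding L1_rel_def by (auto elim: eventually_elim2)

lift_definition minus_L1 :: "L1 \<Rightarrow> L1 \<Rightarrow> L1" is "\<lambda>f g x. f x - g x"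
  unfolding L1_rel_def by (auto elim: eventually_elim2)

lift_definition uminus_L1 :: "L1 \<Rightarrow> L1" is "\<lambda>f x. - f x"
  unfolding L1_rel_def by (auto elim: eventually_mono)

lift_definition scaleR_L1 :: "real \<Rightarrow> L1 \<Rightarrow> L1" is "\<lambda>c f x. c * f x"
  unfolding L1_rel_def by (auto elim: eventually_mono)

lift_definition norm_L1 :: "L1 \<Rightarrow> real"
  is "\<lambda>f. \<integral>x. \<bar>f x\<bar> \<partial>lebesgue_on {0..1}"
  unfolding L1_rel_def
  by (rule integral_cong_AE) (auto elim: eventually_mono)

definition dist_L1 :: "L1 \<Rightarrow> L1 \<Rightarrow> real" where
  "dist_L1 f g = norm (f - g)"

definition sgn_L1 :: "L1 \<Rightarrow> L1" where
  "sgn_L1 f = inverse (norm f) *\<^sub>R f"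

definition uniformity_L1 :: "(L1 \<times> L1) filter" where
  "uniformity_L1 = (INF e\<in>{0<..}. principal {(f, g). dist f g < e})"

definition open_L1 :: "L1 set \<Rightarrow> bool" where
  "open_L1 U \<longleftrightarrow> (\<forall>f\<in>U. eventually (\<lambda>(f', g). f' = f \<longrightarrow> g \<in> U) uniformity)"

instance
proof
  fix f g h :: L1 and a b :: real
  show "f + g + h = f + (g + h)"
    by transfer (simp add: L1_rel_def add.assoc)
  show "f + g = g + f"
    by transfer (simp add: L1_rel_def add.commute)
  show "0 + f = f"
    by transfer (simp add: L1_rel_def)
  show "- f + f = 0"
    by transfer (simp add: L1_rel_def)
  show "f - g = f + - g"
    by transfer (simp add: L1_rel_def)
  show "a *\<^sub>R (f + g) = a *\<^sub>R f + a *\<^sub>R g"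
    by transfer (simp add: L1_rel_def distrib_left)
  show "(a + b) *\<^sub>R f = a *\<^sub>R f + b *\<^sub>R f"
    by transfer (simp add: L1_rel_def distrib_right)
  show "a *\<^sub>R b *\<^sub>R f = (a * b) *\<^sub>R f"
    by transfer (simp add: L1_rel_def mult.assoc)
  show "1 *\<^sub>R f = f"
    by transfer (simp add: L1_rel_def)
  show "dist f g = norm (f - g)"
    by (fact dist_L1_def)
  show "sgn f = inverse (norm f) *\<^sub>R f"
    by (fact sgn_L1_def)
  show "uniformity = (INF e\<in>{0<..}. principal {(f :: L1, g). dist f g < e})"
    by (fact uniformity_L1_def)
  show "open U \<longleftrightarrow> (\<forall>f\<in>U. eventually (\<lambda>(f', g). f' = f \<longrightarrow> g \<in> U) uniformity)"
    for U :: "L1 set"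
    by (fact open_L1_def)
  show "norm f = 0 \<longleftrightarrow> f = 0"
  proof transfer
    fix f assume "L1_rel f f"
    then have int: "integrable (lebesgue_on {0..1}) f"
      by (simp add: L1_rel_refl_iff)
    then have "(\<integral>x. \<bar>f x\<bar> \<partial>lebesgue_on {0..1}) = 0 \<longleftrightarrow>
        (AE x in lebesgue_on {0..1}. \<bar>f x\<bar> = 0)"
      by (intro integral_nonneg_eq_0_iff_AE) auto
    with int show "(\<integral>x. \<bar>f x\<bar> \<partial>lebesgue_on {0..1}) = 0 \<longleftrightarrow> L1_rel f (\<lambda>_. 0)"
      by (simp add: L1_rel_def)
  qed
  show "norm (f + g) \<le> norm f + norm g"
  proof transfer
    fix f g assume "L1_rel f f" "L1_rel g g"
    then have int: "integrable (lebesgue_on {0..1}) f" "integrable (lebesgue_on {0..1}) g"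
      by (simp_all add: L1_rel_refl_iff)
    then have "(\<integral>x. \<bar>f x + g x\<bar> \<partial>lebesgue_on {0..1}) \<le>
        (\<integral>x. \<bar>f x\<bar> + \<bar>g x\<bar> \<partial>lebesgue_on {0..1})"
      by (intro integral_mono integrable_abs Bochner_Integration.integrable_add
           abs_triangle_ineq)
    with int show "(\<integral>x. \<bar>f x + g x\<bar> \<partial>lebesgue_on {0..1}) \<le>
        (\<integral>x. \<bar>f x\<bar> \<partial>lebesgue_on {0..1}) + (\<integral>x. \<bar>g x\<bar> \<partial>lebesgue_on {0..1})"
      by simp
  qed
  show "norm (a *\<^sub>R f) = \<bar>a\<bar> * norm f"
    by transfer (simp add: abs_mult)
qed

end

text \<open>
  Below, a normed space is a linear subspace \<open>X\<close> of a \<open>real_normed_vector\<close>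
  type with the induced norm. Operators on \<open>X\<close> are total functions of which only the
  values on \<open>X\<close> matter.
\<close>

definition bounded_linear_operator_on ::
  "'a::real_normed_vector set \<Rightarrow> ('a \<Rightarrow> 'a) \<Rightarrow> bool" where
  "bounded_linear_operator_on X T \<longleftrightarrow>
     T ` X \<subseteq> X \<and>
     (\<forall>x\<in>X. \<forall>y\<in>X. T (x + y) = T x + T y) \<and>
     (\<forall>c. \<forall>x\<in>X. T (c *\<^sub>R x) = c *\<^sub>R T x) \<and>
     (\<exists>K. \<forall>x\<in>X. norm (T x) \<le> K * norm x)"

text \<open>
  The relative version of \<^const>\<open>onorm\<close>. As there, \<open>x = 0\<close> contributes the
  harmless quotient \<open>0\<close>; the supremum is meaningful for bounded operators only.
\<close>

definition onorm_on :: "'a::real_normed_vector set \<Rightarrow> ('a \<Rightarrow> 'a) \<Rightarrow> real" where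
  "onorm_on X T = (SUP x\<in>X. norm (T x) / norm x)"

definition daugavet_property :: "'a::real_normed_vector set \<Rightarrow> bool" where
  "daugavet_property X \<longleftrightarrow>
     (\<forall>T. bounded_linear_operator_on X T \<and> dim (T ` X) = 1 \<longrightarrow>
        onorm_on X (\<lambda>x. x + T x) = 1 + onorm_on X T)"

definition gateaux_differentiable_norm_at :: "'a::real_normed_vector set \<Rightarrow> 'a \<Rightarrow> bool" where
  "gateaux_differentiable_norm_at X x \<longleftrightarrow>
     (\<forall>h \<in> X \<inter> sphere 0 1.
        ((\<lambda>t. (norm (x + t *\<^sub>R h) + norm (x - t *\<^sub>R h) - 2 * norm x) / t) \<longlongrightarrow> 0) (at 0))"

definition smooth_space :: "'a::real_normed_vector set \<Rightarrow> bool" where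
  "smooth_space X \<longleftrightarrow> (\<forall>x \<in> X - {0}. gateaux_differentiable_norm_at X x)"

end

theory Submission
  imports Defs
begin

text \<open>
  Take for \<open>X\<close> the polynomials. A nonzero polynomial vanishes only on a null set, so the
  difference quotients of the norm converge to \<open>0\<close> pointwise almost everywhere, and
  dominated convergence gives smoothness. By Bernstein's theorem the closure of \<open>X\<close>
  contains all continuous functions, among them ones that are not polynomials.

  For the Daugavet property let \<open>T\<close> have range in the line of \<open>y\<close>, and let
  \<open>norm (g + T g) \<le> K * norm g\<close> on \<open>X\<close>. Bernstein polynomials are a
  partition of unity inside \<open>X\<close>: \<open>f\<close> is the sum of the polynomials
  \<open>f * B n k\<close> and the norms add up as well. Most of the mass of \<open>f * B n k\<close>
  lies close to \<open>k / n\<close>, where \<open>T (f * B n k)\<close>, a multiple of the bounded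
  function \<open>y\<close>, has little mass, so the norm of the sum of the two is almost the sum of
  their norms. Summing over \<open>k\<close> yields
  \<open>norm f + norm (T f) \<le> K * norm f\<close> in the limit.
\<close>

section \<open>The polynomials as a linear subspace of L^1[0,1]\<close>

lemma integrable_continuous_unit:
  fixes f :: "real \<Rightarrow> real"
  assumes "continuous_on {0..1} f"
  shows "integrable (lebesgue_on {0..1}) f"
  using continuous_imp_integrable_real[OF assms] .

lift_definition L1_poly :: "real poly \<Rightarrow> L1" is "\<lambda>p x. poly p x"
  by (auto simp: L1_rel_refl_iff intro!: integrable_continuous_unit continuous_intros)

lemma integrable_poly [simp]: "integrable (lebesgue_on {0..1}) (\<lambda>x. poly p x :: real)"
  by (intro integrable_continuous_unit continuous_intros)

lemma L1_poly_0 [simp]: "L1_poly 0 = 0"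
  by transfer (simp add: L1_rel_def)

lemma L1_poly_add: "L1_poly (p + q) = L1_poly p + L1_poly q"
  by transfer (simp add: L1_rel_def)

lemma L1_poly_smult: "L1_poly (smult c p) = c *\<^sub>R L1_poly p"
  by transfer (simp add: L1_rel_def)

lemma L1_poly_sum: "L1_poly (sum f A) = (\<Sum>i\<in>A. L1_poly (f i))"
  by (induction A rule: infinite_finite_induct) (auto simp: L1_poly_add)

lemma norm_L1_poly: "norm (L1_poly p) = (\<integral>x. \<bar>poly p x\<bar> \<partial>lebesgue_on {0..1})"
  by transfer simp

lemma subspace_range_L1_poly: "subspace (range L1_poly)"
  by (intro subspaceI) (auto simp flip: L1_poly_0 L1_poly_add L1_poly_smult)

text \<open>Otherwise a null set and a finite set would together cover \<open>{a..b}\<close>, which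
  has positive measure. Infinitely many points are enough to identify a polynomial, so this turns
  almost everywhere equality into equality of polynomials.\<close>

lemma AE_unit_infinite:
  assumes "AE x in lebesgue_on {0..1}. P x" "0 \<le> a" "a < b" "b \<le> (1::real)"
  shows "infinite {x \<in> {a..b}. P x}"
proof
  assume fin: "finite {x \<in> {a..b}. P x}"
  have "AE x in lebesgue. x \<in> {0..1} \<longrightarrow> P x"
    using assms(1) by (simp add: AE_restrict_space_iff)
  then obtain N where N: "{x \<in> space lebesgue. \<not> (x \<in> {0..1} \<longrightarrow> P x)} \<subseteq> N" "N \<in> null_sets lebesgue"
    by (auto simp: eventually_ae_filter)
  have "negligible (N \<union> {x \<in> {a..b}. P x})"
    using N(2) fin by (auto simp: negligible_iff_null_sets[symmetric] intro!: negligible_Un negligible_finite)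
  moreover have "{a..b} \<subseteq> N \<union> {x \<in> {a..b}. P x}"
  proof
    fix x assume "x \<in> {a..b}"
    then have "x \<in> {0..1}"
      using assms by simp
    then show "x \<in> N \<union> {x \<in> {a..b}. P x}"
      using N(1) \<open>x \<in> {a..b}\<close> by auto
  qed
  ultimately have "negligible {a..b}"
    by (rule negligible_subset)
  then show False
    using negligible_interval(1)[of a b] \<open>a < b\<close> by (auto simp: box_real)
qed

lemma AE_poly_nonzero:
  assumes "p \<noteq> (0 :: real poly)"
  shows "AE x in lebesgue_on {0..1}. poly p x \<noteq> 0"
proof -
  have "finite {x. poly p x = 0}"
    using assms poly_roots_finite by blast
  then have "{x. poly p x = 0} \<in> null_sets lebesgue"
    using negligible_finite negligible_iff_null_sets by blast
  then have "AE x in lebesgue. poly p x \<noteq> 0"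
    by (auto simp: eventually_ae_filter)
  then show ?thesis
    by (auto simp: AE_restrict_space_iff)
qed

section \<open>A limit of polynomials outside the subspace\<close>

lift_definition L1_ramp :: L1 is "\<lambda>x. max 0 (x - 1/2)"
  by (auto simp: L1_rel_refl_iff intro!: integrable_continuous_unit continuous_intros)

text \<open>The ramp vanishes on the left half, so a polynomial representing it has infinitely many
  roots and is 0. On \<open>{3/4..1}\<close>, however, the ramp is at least 1/4.\<close>

lemma L1_ramp_not_poly: "L1_ramp \<noteq> L1_poly p"
proof
  assume "L1_ramp = L1_poly p"
  then have eq: "AE x in lebesgue_on {0..1}. poly p x = max 0 (x - 1/2)"
    by transfer (auto simp: L1_rel_def elim: eventually_mono)
  have "infinite {x \<in> {0..1/2}. poly p x = max 0 (x - 1/2)}"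
    by (rule AE_unit_infinite[OF eq]) auto
  moreover have "{x \<in> {0..1/2}. poly p x = max 0 (x - 1/2)} \<subseteq> {x. poly p x = 0}"
    by auto
  ultimately have "p = 0"
    using poly_roots_finite finite_subset by metis
  moreover have "infinite {x \<in> {3/4..1}. poly p x = max 0 (x - 1/2)}"
    by (rule AE_unit_infinite[OF eq]) auto
  ultimately show False
    by (auto dest!: infinite_imp_nonempty)
qed

text \<open>The function \<open>Bernstein n k\<close> as an object of type \<open>real poly\<close>,
  so that its product with a polynomial is again an argument of \<open>L1_poly\<close>.\<close>

definition Bernstein_poly :: "nat \<Rightarrow> nat \<Rightarrow> real poly" where
  "Bernstein_poly n k = smult (of_nat (n choose k)) ([:0, 1:] ^ k * [:1, -1:] ^ (n - k))"

lemma poly_Bernstein_poly: "poly (Bernstein_poly n k) x = Bernstein n k x"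
  by (simp add: Bernstein_poly_def Bernstein_def)

lemma sum_Bernstein_poly: "(\<Sum>k\<le>n. Bernstein_poly n k) = 1"
  by (rule poly_eq_poly_eq_iff[THEN iffD1]) (auto simp: poly_sum poly_Bernstein_poly)

lemma not_closed_range_L1_poly: "\<not> closed (range L1_poly)"
proof
  assume closed: "closed (range L1_poly)"
  define g where "g = (\<lambda>x::real. max 0 (x - 1/2))"
  have g: "continuous_on {0..1} g"
    unfolding g_def by (intro continuous_intros)
  have "\<exists>p\<in>range L1_poly. dist p L1_ramp < e" if "e > 0" for e
  proof -
    obtain n where n: "\<And>x. x \<in> {0..1} \<Longrightarrow> \<bar>g x - (\<Sum>k\<le>n. g (k / n) * Bernstein n k x)\<bar> < e / 2"
      using Bernstein_Weierstrass[OF g, of "e/2"] \<open>e > 0\<close> by auto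
    define p where "p = (\<Sum>k\<le>n. smult (g (k / n)) (Bernstein_poly n k))"
    have p: "\<bar>poly p x - g x\<bar> \<le> e / 2" if "x \<in> {0..1}" for x
      using n[OF that] by (simp add: p_def poly_sum poly_Bernstein_poly abs_minus_commute)
    have "norm (L1_poly p - L1_ramp) = (\<integral>x. \<bar>poly p x - g x\<bar> \<partial>lebesgue_on {0..1})"
      unfolding g_def by transfer simp
    \<comment> \<open>The interval has measure 1, so a uniform bound is also a bound in L^1;
      \<open>e / 2\<close> leaves room for the strict inequality.\<close>
    also have "\<dots> \<le> (\<integral>x. e / 2 \<partial>lebesgue_on {0..1::real})"
      using p g by (intro integral_mono integrable_continuous_unit continuous_intros) auto
    also have "\<dots> < e"
      using \<open>e > 0\<close> by (simp add: measure_restrict_space)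
    finally show ?thesis
      by (auto simp: dist_norm)
  qed
  then have "L1_ramp \<in> range L1_poly"
    using closed closed_approachable by blast
  then show False
    using L1_ramp_not_poly by blast
qed

section \<open>Smoothness\<close>

lemma smooth_range_L1_poly: "smooth_space (range L1_poly)"
  unfolding smooth_space_def gateaux_differentiable_norm_at_def
proof safe
  fix p q assume nz: "L1_poly p \<noteq> 0"
  let ?F = "\<lambda>t x. (\<bar>poly p x + t * poly q x\<bar> + \<bar>poly p x - t * poly q x\<bar> - 2 * \<bar>poly p x\<bar>) / t"
  have int: "(norm (L1_poly p + t *\<^sub>R L1_poly q) + norm (L1_poly p - t *\<^sub>R L1_poly q)
      - 2 * norm (L1_poly p)) / t = (\<integral>x. ?F t x \<partial>lebesgue_on {0..1})" for t
  proof -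
    have "norm (L1_poly p + t *\<^sub>R L1_poly q) = (\<integral>x. \<bar>poly p x + t * poly q x\<bar> \<partial>lebesgue_on {0..1})"
      "norm (L1_poly p - t *\<^sub>R L1_poly q) = (\<integral>x. \<bar>poly p x - t * poly q x\<bar> \<partial>lebesgue_on {0..1})"
      by (transfer; simp)+
    moreover have "integrable (lebesgue_on {0..1}) (\<lambda>x. \<bar>poly p x + t * poly q x\<bar>)"
      "integrable (lebesgue_on {0..1}) (\<lambda>x. \<bar>poly p x - t * poly q x\<bar>)"
      "integrable (lebesgue_on {0..1}) (\<lambda>x. \<bar>poly p x\<bar>)"
      by (intro integrable_continuous_unit continuous_intros)+
    ultimately show ?thesis
      by (simp add: norm_L1_poly)
  qed
  have ae: "AE x in lebesgue_on {0..1}. poly p x \<noteq> 0"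
    using nz by (intro AE_poly_nonzero) auto
  show "((\<lambda>t. (norm (L1_poly p + t *\<^sub>R L1_poly q) + norm (L1_poly p - t *\<^sub>R L1_poly q)
      - 2 * norm (L1_poly p)) / t) \<longlongrightarrow> 0) (at 0)"
    \<comment> \<open>Passing to sequences makes dominated convergence applicable.\<close>
    unfolding int tendsto_at_iff_sequentially o_def
  proof safe
    fix s :: "nat \<Rightarrow> real" assume s: "\<forall>i. s i \<in> UNIV - {0}" "s \<longlonglongrightarrow> 0"
    have "(\<lambda>i. \<integral>x. ?F (s i) x \<partial>lebesgue_on {0..1}) \<longlonglongrightarrow> (\<integral>x. 0 \<partial>lebesgue_on {0..1::real})"
    proof (rule integral_dominated_convergence)
      show "integrable (lebesgue_on {0..1}) (\<lambda>x. 2 * \<bar>poly q x\<bar>)"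
        by (intro integrable_continuous_unit continuous_intros)
      show "(\<lambda>x. ?F (s i) x) \<in> borel_measurable (lebesgue_on {0..1})" for i
        using s by (intro borel_measurable_integrable integrable_continuous_unit continuous_intros) auto
      show "AE x in lebesgue_on {0..1}. (\<lambda>i. ?F (s i) x) \<longlonglongrightarrow> 0"
        using ae
      proof eventually_elim
        case (elim x)
        \<comment> \<open>Once the perturbation is smaller than \<open>\<bar>poly p x\<bar>\<close>,
          neither \<open>+\<close> nor \<open>-\<close> changes the sign, so the two absolute values
          average to \<open>\<bar>poly p x\<bar>\<close> and the quotient is exactly 0.\<close>
        have "(\<lambda>i. s i * poly q x) \<longlonglongrightarrow> 0"
          using tendsto_mult_left_zero[OF s(2)] by simp
        then have "\<forall>\<^sub>F i in sequentially. \<bar>s i * poly q x\<bar> < \<bar>poly p x\<bar>"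
          using elim by (auto simp: tendsto_iff dist_real_def)
        then have "\<forall>\<^sub>F i in sequentially. ?F (s i) x = 0"
          by eventually_elim auto
        then show ?case
          by (rule tendsto_eventually)
      qed
      show "AE x in lebesgue_on {0..1}. norm (?F (s i) x) \<le> 2 * \<bar>poly q x\<bar>" for i
      proof (rule AE_I2)
        fix x
        \<comment> \<open>With b = \<open>s i * poly q x\<close>, dividing by \<open>s i\<close>
          leaves a bound independent of i.\<close>
        have "\<bar>\<bar>a + b\<bar> + \<bar>a - b\<bar> - 2 * \<bar>a\<bar>\<bar> \<le> 2 * \<bar>b\<bar>" for a b :: real
          by arith
        from this[of "poly p x" "s i * poly q x"] show "norm (?F (s i) x) \<le> 2 * \<bar>poly q x\<bar>"
          using s(1) by (simp add: field_simps abs_mult)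
      qed
    qed simp
    then show "(\<lambda>i. \<integral>x. ?F (s i) x \<partial>lebesgue_on {0..1}) \<longlonglongrightarrow> 0"
      by simp
  qed
qed

section \<open>The Daugavet property\<close>

text \<open>One inequality between the operator norms is the triangle inequality. For the other,
  \<open>lower\<close> is applied with K the norm of Id + T; stating it for arbitrary K keeps
  suprema out of the main argument.\<close>

lemma daugavet_propertyI:
  assumes X: "subspace X"
    and lower: "\<And>T y K. bounded_linear_operator_on X T \<Longrightarrow> y \<in> X \<Longrightarrow> y \<noteq> 0 \<Longrightarrow> T ` X \<subseteq> span {y} \<Longrightarrow>
      (\<And>x. x \<in> X \<Longrightarrow> norm (x + T x) \<le> K * norm x) \<Longrightarrow>
      (\<And>x. x \<in> X \<Longrightarrow> norm x + norm (T x) \<le> K * norm x)"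
  shows "daugavet_property X"
  unfolding daugavet_property_def
proof safe
  fix T assume T: "bounded_linear_operator_on X T" and "dim (T ` X) = 1"
  then obtain B where "B \<subseteq> T ` X" "independent B" "T ` X \<subseteq> span B" "card B = 1"
    using basis_exists[of "T ` X"] by metis
  then obtain y where y: "y \<in> T ` X" "y \<noteq> 0" "T ` X \<subseteq> span {y}"
    by (auto simp: card_1_singleton_iff)
  obtain C where C: "\<And>x. x \<in> X \<Longrightarrow> norm (T x) \<le> C * norm x" and "T ` X \<subseteq> X"
    using T unfolding bounded_linear_operator_on_def by blast
  then have "y \<in> X"
    using y by blast
  let ?N = "onorm_on X T" and ?K = "onorm_on X (\<lambda>x. x + T x)"
  have "norm (T x) / norm x \<le> \<bar>C\<bar>" if "x \<in> X" for x
    using order_trans[OF C[OF that] mult_right_mono[of C "\<bar>C\<bar>" "norm x"]] by (simp add: divide_simps)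
  then have bdd: "bdd_above ((\<lambda>x. norm (T x) / norm x) ` X)"
    by (auto intro!: bdd_aboveI2)
  have quotient: "norm (x + T x) / norm x \<le> 1 + norm (T x) / norm x" for x
    using norm_triangle_ineq[of x "T x"] by (cases "x = 0") (simp_all add: field_simps)
  have upper: "norm (x + T x) / norm x \<le> 1 + ?N" if "x \<in> X" for x
    using quotient[of x] cSUP_upper[OF that bdd] unfolding onorm_on_def by linarith
  have "X \<noteq> {}"
    using \<open>y \<in> X\<close> by blast
  have "?K \<le> 1 + ?N"
    unfolding onorm_on_def[of X "\<lambda>x. x + T x"] using \<open>X \<noteq> {}\<close> upper by (intro cSUP_least)
  moreover have "?N \<le> ?K - 1"
  proof -
    have bdd': "bdd_above ((\<lambda>x. norm (x + T x) / norm x) ` X)"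
      using upper by (auto intro!: bdd_aboveI2)
    have K: "norm (x + T x) \<le> ?K * norm x" if "x \<in> X" for x
    proof (cases "x = 0")
      case True
      then show ?thesis
        using C[OF that] by simp
    next
      case False
      then show ?thesis
        using cSUP_upper[OF that bdd'] unfolding onorm_on_def by (simp add: field_simps)
    qed
    have main: "norm x + norm (T x) \<le> ?K * norm x" if "x \<in> X" for x
      using lower[OF T \<open>y \<in> X\<close> y(2,3) K that] .
    \<comment> \<open>The quotient at x = 0 is 0 by convention, so the bound there amounts to 1
      \<le> \<open>?K\<close>; the nonzero vector y supplies it.\<close>
    have "1 * norm y \<le> ?K * norm y"
      using main[OF \<open>y \<in> X\<close>] norm_ge_zero[of "T y"] by linarith
    then have "1 \<le> ?K"
      using \<open>y \<noteq> 0\<close> by simp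
    have "norm (T x) / norm x \<le> ?K - 1" if "x \<in> X" for x
      using main[OF that] \<open>1 \<le> ?K\<close> by (cases "x = 0") (simp_all add: field_simps)
    then show ?thesis
      unfolding onorm_on_def[of X T] using \<open>X \<noteq> {}\<close> by (intro cSUP_least)
  qed
  ultimately show "?K = 1 + ?N"
    by simp
qed

text \<open>This is the variance of k / n for k binomially distributed with parameters n and
  x.\<close>

lemma sum_Bernstein_variance:
  assumes "n > 0"
  shows "(\<Sum>k\<le>n. Bernstein n k x * (x - k / n)\<^sup>2) = x * (1 - x) / n"
proof -
  \<comment> \<open>Uses (n x - k)^2 = k (k - 1) + (1 - 2 n x) k + (n x)^2, whose three terms have
    known Bernstein sums.\<close>
  have "(\<Sum>k\<le>n. real k * (real k - 1) * Bernstein n k x) + (1 - 2 * n * x) * (\<Sum>k\<le>n. k * Bernstein n k x)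
      + (n * x)\<^sup>2 * (\<Sum>k\<le>n. Bernstein n k x) = n * x * (1 - x)"
    unfolding sum_kk_Bernstein sum_k_Bernstein sum_Bernstein by (simp add: algebra_simps power2_eq_square)
  also have "(\<Sum>k\<le>n. real k * (real k - 1) * Bernstein n k x) + (1 - 2 * n * x) * (\<Sum>k\<le>n. k * Bernstein n k x)
      + (n * x)\<^sup>2 * (\<Sum>k\<le>n. Bernstein n k x) = (\<Sum>k\<le>n. n\<^sup>2 * (Bernstein n k x * (x - k / n)\<^sup>2))"
    unfolding sum_distrib_left sum.distrib[symmetric]
    using assms by (intro sum.cong refl) (simp add: field_simps power2_eq_square)
  also have "\<dots> = n\<^sup>2 * (\<Sum>k\<le>n. Bernstein n k x * (x - k / n)\<^sup>2)"
    by (simp only: sum_distrib_left)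
  finally have "n * (n * (\<Sum>k\<le>n. Bernstein n k x * (x - k / n)\<^sup>2)) = n * (x * (1 - x))"
    by (simp add: power2_eq_square mult.assoc)
  then have "n * (\<Sum>k\<le>n. Bernstein n k x * (x - k / n)\<^sup>2) = x * (1 - x)"
    using assms by simp
  then show ?thesis
    using assms by (simp add: eq_divide_eq mult.commute)
qed

text \<open>A Chebyshev argument: cancellation inside the window of radius d around z costs at most
  2 M \<open>\<bar>c\<bar>\<close> times its length 2 d, and outside it is controlled by the second
  moment of \<open>\<bar>poly p x\<bar>\<close> about z.\<close>

lemma norm_plus_localised_ge:
  assumes M: "\<And>x. x \<in> {0..1} \<Longrightarrow> \<bar>poly q x\<bar> \<le> M" and d: "0 < d"
  shows "norm (L1_poly p) + norm (c *\<^sub>R L1_poly q) - 4 * d * M * \<bar>c\<bar>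
    \<le> norm (L1_poly p + c *\<^sub>R L1_poly q)
      + 2 / d\<^sup>2 * (\<integral>x. \<bar>poly p x\<bar> * (x - z)\<^sup>2 \<partial>lebesgue_on {0..1})"
proof -
  have "0 \<le> M"
    using M[of 0] by simp
  let ?I = "indicator {z - d..z + d} :: real \<Rightarrow> real"
  have I [simp]: "integrable (lebesgue_on {0..1}) ?I"
    by (simp add: integrable_indicator_iff emeasure_restrict_space sets_restrict_space_iff emeasure_lborel_Icc_eq)
  have J: "(\<integral>x. ?I x \<partial>lebesgue_on {0..1}) \<le> 2 * d"
  proof -
    have "(\<integral>x. ?I x \<partial>lebesgue_on {0..1}) = measure lebesgue ({z - d..z + d} \<inter> {0..1})"
      by (simp add: measure_restrict_space)
    also have "\<dots> \<le> measure lebesgue {z - d..z + d}"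
      by (intro measure_mono_fmeasurable) auto
    also have "\<dots> = 2 * d"
      using d by simp
    finally show ?thesis .
  qed
  have V [simp]: "integrable (lebesgue_on {0..1}) (\<lambda>x. \<bar>poly p x\<bar> * (x - z)\<^sup>2)"
    "integrable (lebesgue_on {0..1}) (\<lambda>x. \<bar>poly p x + c * poly q x\<bar>)"
    by (intro integrable_continuous_unit continuous_intros)+
  \<comment> \<open>\<open>\<bar>a\<bar> + \<bar>b\<bar> \<le> \<bar>a + b\<bar> + 2 * min \<bar>a\<bar> \<bar>b\<bar>\<close>; the minimum is bounded by \<open>\<bar>b\<bar>\<close> near \<open>z\<close>, and by
    \<open>\<bar>a\<bar> * ((x - z) / d)\<^sup>2\<close> away from \<open>z\<close>.\<close>
  have pointwise: "\<bar>poly p x\<bar> + \<bar>c * poly q x\<bar>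
      \<le> \<bar>poly p x + c * poly q x\<bar> + (2 / d\<^sup>2 * (\<bar>poly p x\<bar> * (x - z)\<^sup>2) + 2 * M * \<bar>c\<bar> * ?I x)"
    if "x \<in> {0..1}" for x
  proof (cases "\<bar>x - z\<bar> \<le> d")
    case True
    then have "?I x = 1"
      by (simp add: abs_le_iff)
    moreover have "\<bar>c * poly q x\<bar> \<le> M * \<bar>c\<bar>"
      using mult_right_mono[OF M[OF that], of "\<bar>c\<bar>"] by (simp add: abs_mult mult.commute)
    moreover have "0 \<le> 2 / d\<^sup>2 * (\<bar>poly p x\<bar> * (x - z)\<^sup>2)"
      by simp
    ultimately show ?thesis
      unfolding \<open>?I x = 1\<close> by argo
  next
    case False
    then have "d\<^sup>2 \<le> (x - z)\<^sup>2"
      using d power_mono[of d "\<bar>x - z\<bar>" 2] by simp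
    then have "\<bar>poly p x\<bar> * d\<^sup>2 \<le> \<bar>poly p x\<bar> * (x - z)\<^sup>2"
      by (rule mult_left_mono) simp
    then have "2 * \<bar>poly p x\<bar> \<le> 2 / d\<^sup>2 * (\<bar>poly p x\<bar> * (x - z)\<^sup>2)"
      using d by (simp add: field_simps)
    moreover have "0 \<le> 2 * M * \<bar>c\<bar> * ?I x"
      using \<open>0 \<le> M\<close> by simp
    ultimately show ?thesis
      by arith
  qed
  have "norm (L1_poly p) + norm (c *\<^sub>R L1_poly q)
      = (\<integral>x. \<bar>poly p x\<bar> + \<bar>c * poly q x\<bar> \<partial>lebesgue_on {0..1})"
    by (simp add: norm_L1_poly flip: L1_poly_smult)
  also have "\<dots> \<le> (\<integral>x. \<bar>poly p x + c * poly q x\<bar>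
      + (2 / d\<^sup>2 * (\<bar>poly p x\<bar> * (x - z)\<^sup>2) + 2 * M * \<bar>c\<bar> * ?I x) \<partial>lebesgue_on {0..1})"
    using pointwise by (intro integral_mono Bochner_Integration.integrable_add integrable_abs
      integrable_mult_right V I) (auto simp: integrable_poly)
  also have "\<dots> = norm (L1_poly p + c *\<^sub>R L1_poly q)
      + (2 / d\<^sup>2 * (\<integral>x. \<bar>poly p x\<bar> * (x - z)\<^sup>2 \<partial>lebesgue_on {0..1})
      + 2 * M * \<bar>c\<bar> * (\<integral>x. ?I x \<partial>lebesgue_on {0..1}))"
    by (simp add: norm_L1_poly flip: L1_poly_smult L1_poly_add)
  finally show ?thesis
    using mult_left_mono[OF J, of "2 * M * \<bar>c\<bar>"] \<open>0 \<le> M\<close> by (simp add: algebra_simps)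
qed

lemma daugavet_range_L1_poly: "daugavet_property (range L1_poly)"
proof (rule daugavet_propertyI[OF subspace_range_L1_poly])
  fix T y K f
  assume T: "bounded_linear_operator_on (range L1_poly) T"
    and "y \<in> range L1_poly" "y \<noteq> 0" and span: "T ` range L1_poly \<subseteq> span {y}"
    and K: "\<And>x. x \<in> range L1_poly \<Longrightarrow> norm (x + T x) \<le> K * norm x"
    and "f \<in> range L1_poly"
  then obtain q p where y: "y = L1_poly q" and f: "f = L1_poly p"
    by blast
  obtain C where C: "\<And>p. norm (T (L1_poly p)) \<le> C * norm (L1_poly p)"
    using T unfolding bounded_linear_operator_on_def by blast
  have T_add: "T (L1_poly p + L1_poly q) = T (L1_poly p) + T (L1_poly q)" for p q
    using T unfolding bounded_linear_operator_on_def by blast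
  have T_0: "T 0 = 0"
    using T_add[of 0 0] by simp
  have T_sum: "T (\<Sum>i\<in>A. L1_poly (g i)) = (\<Sum>i\<in>A. T (L1_poly (g i)))" for g and A :: "nat set"
    by (induction A rule: infinite_finite_induct) (simp_all add: T_0 T_add[of _ "sum g _" for g, unfolded L1_poly_sum])
  have "\<exists>c. T (L1_poly r) = c *\<^sub>R y" for r
    using subsetD[OF span, of "T (L1_poly r)"] by (auto simp: span_singleton)
  then obtain c where c: "\<And>r. T (L1_poly r) = c r *\<^sub>R L1_poly q"
    unfolding y by metis
  have "bounded (poly q ` {0..1})"
    by (intro compact_imp_bounded compact_continuous_image continuous_intros) auto
  then obtain M where M: "\<And>x. x \<in> {0..1} \<Longrightarrow> \<bar>poly q x\<bar> \<le> M"
    unfolding bounded_iff by force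
  then have "0 \<le> M"
    by (metis abs_ge_zero atLeastAtMost_iff order_refl order_trans zero_le_one)
  \<comment> \<open>The first summand comes from the second moments, as 2 m^2 \<open>norm f\<close>
    / m^3 = 2 \<open>norm f\<close> / m; the second comes from the windows of radius 1 / m.\<close>
  define D where "D = 2 * norm f + 4 * M * (C * norm f / norm y)"
  have bound: "norm f + norm (T f) \<le> K * norm f + D / m" if "m > 0" for m :: nat
  proof -
    \<comment> \<open>With window radius \<open>1 / m\<close>, the Bernstein degree must grow faster than
      \<open>m\<^sup>2\<close> for the mass outside the windows to vanish.\<close>
    define n where "n = m ^ 3"
    have "n > 0"
      using that by (simp add: n_def)
    define P where "P k = Bernstein_poly n k * p" for k
    define V where "V k = (\<integral>x. \<bar>poly (P k) x\<bar> * (x - k / n)\<^sup>2 \<partial>lebesgue_on {0..1})" for k :: nat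
    have poly_P: "\<bar>poly (P k) x\<bar> = Bernstein n k x * \<bar>poly p x\<bar>" if "x \<in> {0..1}" for k x
      using that Bernstein_nonneg[of x n k] by (simp add: P_def poly_Bernstein_poly abs_mult)
    have f_sum: "f = (\<Sum>k\<le>n. L1_poly (P k))"
      unfolding P_def L1_poly_sum[symmetric] sum_distrib_right[symmetric] sum_Bernstein_poly f by simp
    have norm_P_sum: "(\<Sum>k\<le>n. norm (L1_poly (P k))) = norm f"
    proof -
      have "(\<Sum>k\<le>n. norm (L1_poly (P k))) = (\<integral>x. (\<Sum>k\<le>n. \<bar>poly (P k) x\<bar>) \<partial>lebesgue_on {0..1})"
        by (simp add: norm_L1_poly)
      also have "\<dots> = norm f"
        unfolding f norm_L1_poly
        by (intro Bochner_Integration.integral_cong refl) (auto simp: poly_P sum_distrib_right[symmetric])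
      finally show ?thesis .
    qed
    \<comment> \<open>Summed over k, the second moments give the integral of
      \<open>\<bar>poly p x\<bar>\<close> times the binomial variance, which is at most 1 / n on
      [0,1].\<close>
    have V_sum: "(\<Sum>k\<le>n. V k) \<le> norm f / n"
    proof -
      have int: "integrable (lebesgue_on {0..1}) (\<lambda>x. \<bar>poly (P k) x\<bar> * (x - k / n)\<^sup>2)" for k
        by (intro integrable_continuous_unit continuous_intros)
      have "(\<Sum>k\<le>n. V k) = (\<integral>x. (\<Sum>k\<le>n. \<bar>poly (P k) x\<bar> * (x - k / n)\<^sup>2) \<partial>lebesgue_on {0..1})"
        unfolding V_def using int by simp
      also have "\<dots> \<le> (\<integral>x. \<bar>poly p x\<bar> / n \<partial>lebesgue_on {0..1})"
      proof (rule integral_mono)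
        fix x :: real assume "x \<in> space (lebesgue_on {0..1})"
        then have x: "x \<in> {0..1}"
          by simp
        have "(\<Sum>k\<le>n. \<bar>poly (P k) x\<bar> * (x - k / n)\<^sup>2)
            = \<bar>poly p x\<bar> * (\<Sum>k\<le>n. Bernstein n k x * (x - k / n)\<^sup>2)"
          unfolding sum_distrib_left using x by (intro sum.cong) (auto simp: poly_P)
        also have "\<dots> = \<bar>poly p x\<bar> / n * (x * (1 - x))"
          unfolding sum_Bernstein_variance[OF \<open>n > 0\<close>] by simp
        also have "\<dots> \<le> \<bar>poly p x\<bar> / n"
          using x mult_mono[of x 1 "1 - x" 1] by (intro mult_right_le_one_le) auto
        finally show "(\<Sum>k\<le>n. \<bar>poly (P k) x\<bar> * (x - k / n)\<^sup>2) \<le> \<bar>poly p x\<bar> / n" .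
      qed (use int in auto)
      finally show ?thesis
        by (simp add: f norm_L1_poly)
    qed
    \<comment> \<open>Since the norms of the pieces add up to \<open>norm f\<close>, boundedness of
      T controls the sum of all coefficients independently of n.\<close>
    have "norm (T f) \<le> (\<Sum>k\<le>n. norm (T (L1_poly (P k))))"
      unfolding f_sum T_sum by (rule norm_sum)
    moreover have "(\<Sum>k\<le>n. norm (T (L1_poly (P k)))) \<le> C * norm f"
      unfolding norm_P_sum[symmetric] sum_distrib_left by (intro sum_mono C)
    moreover have "norm (T (L1_poly (P k))) = \<bar>c (P k)\<bar> * norm y" for k
      by (simp add: c y)
    ultimately have Tf: "norm (T f) \<le> (\<Sum>k\<le>n. norm (T (L1_poly (P k))))"
      and c_sum: "(\<Sum>k\<le>n. \<bar>c (P k)\<bar>) \<le> C * norm f / norm y"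
      using \<open>y \<noteq> 0\<close> by (auto simp: field_simps simp flip: sum_distrib_left sum_distrib_right)
    have "norm (L1_poly (P k)) + norm (T (L1_poly (P k)))
        \<le> norm (L1_poly (P k) + T (L1_poly (P k))) + 2 * m\<^sup>2 * V k + 4 * M / m * \<bar>c (P k)\<bar>" for k
      using norm_plus_localised_ge[OF M, of "1 / m" "P k" "c (P k)" "k / n"] \<open>m > 0\<close>
      unfolding V_def[symmetric] c[symmetric] by (simp add: field_simps)
    \<comment> \<open>The bound by K is applied to each piece separately; as the norms of the pieces
      add up exactly, summation loses nothing on the right.\<close>
    then have "norm (L1_poly (P k)) + norm (T (L1_poly (P k)))
        \<le> K * norm (L1_poly (P k)) + 2 * m\<^sup>2 * V k + 4 * M / m * \<bar>c (P k)\<bar>" for k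
      using K[of "L1_poly (P k)"] by (smt (verit) rangeI)
    then have "(\<Sum>k\<le>n. norm (L1_poly (P k)) + norm (T (L1_poly (P k))))
        \<le> (\<Sum>k\<le>n. K * norm (L1_poly (P k)) + 2 * m\<^sup>2 * V k + 4 * M / m * \<bar>c (P k)\<bar>)"
      by (rule sum_mono)
    then have "norm f + (\<Sum>k\<le>n. norm (T (L1_poly (P k))))
        \<le> K * norm f + 2 * m\<^sup>2 * (\<Sum>k\<le>n. V k) + 4 * M / m * (\<Sum>k\<le>n. \<bar>c (P k)\<bar>)"
      by (simp only: sum.distrib sum_distrib_left[symmetric] norm_P_sum)
    also have "\<dots> \<le> K * norm f + 2 * m\<^sup>2 * (norm f / n) + 4 * M / m * (C * norm f / norm y)"
      using \<open>0 \<le> M\<close> by (intro add_mono mult_left_mono V_sum c_sum order_refl) auto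
    also have "\<dots> = K * norm f + D / m"
      using \<open>m > 0\<close> by (simp add: D_def n_def field_simps power2_eq_square power3_eq_cube)
    finally show ?thesis
      using Tf by simp
  qed
  \<comment> \<open>\<open>Suc m\<close> ranges over the positive integers that \<open>bound\<close>
    requires.\<close>
  have "(\<lambda>m. K * norm f + D / real (Suc m)) \<longlonglongrightarrow> K * norm f + 0"
    by (intro tendsto_intros lim_const_over_n[THEN LIMSEQ_Suc])
  moreover have "norm f + norm (T f) \<le> K * norm f + D / real (Suc m)" for m
    by (rule bound) simp
  ultimately show "norm f + norm (T f) \<le> K * norm f"
    by (auto dest: LIMSEQ_le_const)
qed

theorem theorem2p3:
  "\<exists>X :: L1 set. subspace X \<and> \<not> closed X \<and> daugavet_property X \<and> smooth_space X"
  using subspace_range_L1_poly not_closed_range_L1_poly daugavet_range_L1_poly smooth_range_L1_poly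
  by blast

end
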